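(* Let $G$ be a finite simple graph embedded in a closed surface, let $\mathcal F\neq\mathcal F(G)$ be a set of even faces, and let $H$ be a connected component of $R(G;\mathcal F)$. Let $\{f_1,\dots,f_k\}$ be the set of all faces corresponding to edges of $H$. For each $i$, the quotient graph $\mathcal H_i$ is bipartite; fix a bipartition $(A_i,B_i)$ of it, and define $\ell_i:V(H)\to\{0,1\}$ by $\ell_i(M)=0$ if the component of $H\setminus E_i$ containing $M$ corresponds to a vertex in $A_i$, and $\ell_i(M)=1$ if it corresponds to a vertex in $B_i$. Let $\ell(M)=(\ell_1(M),\dots,\ell_k(M))$. Then $\ell:V(H)\to\{0,1\}^k$ is an embedding of $H$ into the $k$-dimensional hypercube $Q_k$ as an induced subgraph: $\ell$ is injective, and for all $M,M'\in V(H)$, $MM'\in E(H)$ if and only if $\ell(M)$ and $\ell(M')$ differ in exactly one coordinate.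
   Context: A closed surface is a compact connected 2-dimensional manifold without boundary. A face of $G$ is the closure of a connected component of $\Sigma\setminus G$; $E(f)$ is the set of edges on the boundary of $f$, and $\mathcal F(G)$ is the set of all faces. A face is even if its boundary is a cycle of even length. The resonance graph $R(G;\mathcal F)$ has vertex set the perfect matchings of $G$, with $M_1\sim M_2$ iff $M_1\oplus M_2=E(f)$ for some $f\in\mathcal F$; an edge $MM'$ corresponds to face $f$ if $M\oplus M'=E(f)$. $E_i$ denotes the set of edges of $H$ corresponding to $f_i$, and $H\setminus E_i$ the graph obtained from $H$ by deleting $E_i$. The quotient graph $\mathcal H_i$ is obtained from $H$ by contracting all edges of $E(H)\setminus E_i$ and replacing parallel edges by single edges; its vertices correspond to the connected components of $H\setminus E_i$. $Q_k$ is the graph on binary strings of length $k$, two being adjacent iff they differ in exactly one position. *)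

theory Defs
  imports "HOL-Analysis.Analysis"
begin

section \<open>Undirected graphs\<close>

text \<open>A graph is a pair of a vertex set and a set of edges, an edge being the set of its ends.
  A singleton edge is a loop; quotient graphs may a priori have loops.\<close>

type_synonym 'v ugraph = "'v set \<times> 'v set set"

abbreviation verts :: "'v ugraph \<Rightarrow> 'v set" where "verts G \<equiv> fst G"
abbreviation edges :: "'v ugraph \<Rightarrow> 'v set set" where "edges G \<equiv> snd G"

definition finite_simple_graph :: "'v ugraph \<Rightarrow> bool" where
  "finite_simple_graph G \<longleftrightarrow>
     finite (verts G) \<and> (\<forall>e\<in>edges G. e \<subseteq> verts G \<and> card e = 2)"

definition component_of :: "'v ugraph \<Rightarrow> 'v \<Rightarrow> 'v set" where
  "component_of G v = {w \<in> verts G. (\<lambda>x y. {x, y} \<in> edges G)\<^sup>*\<^sup>* v w}"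

definition component_sets :: "'v ugraph \<Rightarrow> 'v set set" where
  "component_sets G = component_of G ` verts G"

definition connected_component_graph :: "'v ugraph \<Rightarrow> 'v ugraph \<Rightarrow> bool" where
  "connected_component_graph H G \<longleftrightarrow>
     (\<exists>C\<in>component_sets G. H = (C, {e \<in> edges G. e \<subseteq> C}))"

definition delete_edges :: "'v ugraph \<Rightarrow> 'v set set \<Rightarrow> 'v ugraph" where
  "delete_edges G S = (verts G, edges G - S)"

text \<open>Contraction of all edges outside \<open>S\<close>, with parallel edges identified. An edge of \<open>S\<close>
  with both ends in one component of \<open>delete_edges G S\<close> becomes a loop.\<close>

definition quotient_graph :: "'v ugraph \<Rightarrow> 'v set set \<Rightarrow> 'v set ugraph" where
  "quotient_graph G S =
     (component_sets (delete_edges G S),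
      {{C, D} | C D. C \<in> component_sets (delete_edges G S) \<and> D \<in> component_sets (delete_edges G S) \<and>
                     (\<exists>x\<in>C. \<exists>y\<in>D. {x, y} \<in> edges G \<inter> S)})"

definition bipartition :: "'v ugraph \<Rightarrow> 'v set \<Rightarrow> 'v set \<Rightarrow> bool" where
  "bipartition G A B \<longleftrightarrow>
     A \<union> B = verts G \<and> A \<inter> B = {} \<and> (\<forall>e\<in>edges G. \<exists>a\<in>A. \<exists>b\<in>B. e = {a, b})"

definition bipartite :: "'v ugraph \<Rightarrow> bool" where
  "bipartite G \<longleftrightarrow> (\<exists>A B. bipartition G A B)"

definition perfect_matching :: "'v ugraph \<Rightarrow> 'v set set \<Rightarrow> bool" where
  "perfect_matching G M \<longleftrightarrow> M \<subseteq> edges G \<and> (\<forall>v\<in>verts G. \<exists>!e. e \<in> M \<and> v \<in> e)"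

definition cycle_edges :: "'v list \<Rightarrow> 'v set set" where
  "cycle_edges vs = {{vs ! i, vs ! (Suc i mod length vs)} | i. i < length vs}"

definition cycle_in :: "'v ugraph \<Rightarrow> 'v list \<Rightarrow> bool" where
  "cycle_in G vs \<longleftrightarrow>
     distinct vs \<and> 3 \<le> length vs \<and> set vs \<subseteq> verts G \<and> cycle_edges vs \<subseteq> edges G"

definition hypercube :: "nat \<Rightarrow> nat list ugraph" where
  "hypercube k =
     (let W = {xs. length xs = k \<and> set xs \<subseteq> {0, 1}}
      in (W, {{xs, ys} | xs ys. xs \<in> W \<and> ys \<in> W \<and> card {i. i < k \<and> xs ! i \<noteq> ys ! i} = 1}))"

definition induced_subgraph_embedding :: "('v \<Rightarrow> 'w) \<Rightarrow> 'v ugraph \<Rightarrow> 'w ugraph \<Rightarrow> bool" where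
  "induced_subgraph_embedding h G K \<longleftrightarrow>
     h ` verts G \<subseteq> verts K \<and> inj_on h (verts G) \<and>
     (\<forall>u\<in>verts G. \<forall>v\<in>verts G. {u, v} \<in> edges G \<longleftrightarrow> {h u, h v} \<in> edges K)"


section \<open>Graphs embedded in closed surfaces\<close>

text \<open>Second countability is automatic for a compact locally Euclidean space.\<close>

definition closed_surface :: "'s topology \<Rightarrow> bool" where
  "closed_surface X \<longleftrightarrow>
     Hausdorff_space X \<and> compact_space X \<and> connected_space X \<and>
     (\<forall>x\<in>topspace X. \<exists>U. openin X U \<and> x \<in> U \<and>
        subtopology X U homeomorphic_space (euclidean :: (real ^ 2) topology))"

record ('v, 's) drawing =
  vpoint :: "'v \<Rightarrow> 's"
  ecurve :: "'v set \<Rightarrow> real \<Rightarrow> 's"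

definition embedded_in :: "'s topology \<Rightarrow> 'v ugraph \<Rightarrow> ('v, 's) drawing \<Rightarrow> bool" where
  "embedded_in X G D \<longleftrightarrow>
     vpoint D ` verts G \<subseteq> topspace X \<and> inj_on (vpoint D) (verts G) \<and>
     (\<forall>e\<in>edges G.
        embedding_map (top_of_set {0..1}) X (ecurve D e) \<and>
        {ecurve D e 0, ecurve D e 1} = vpoint D ` e \<and>
        ecurve D e ` {0<..<1} \<inter> vpoint D ` verts G = {}) \<and>
     (\<forall>e\<in>edges G. \<forall>e'\<in>edges G. e \<noteq> e' \<longrightarrow>
        ecurve D e ` {0<..<1} \<inter> ecurve D e' ` {0<..<1} = {})"

definition eset :: "('v, 's) drawing \<Rightarrow> 'v set \<Rightarrow> 's set" where
  "eset D e = ecurve D e ` {0..1}"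

definition point_set :: "'v ugraph \<Rightarrow> ('v, 's) drawing \<Rightarrow> 's set" where
  "point_set G D = vpoint D ` verts G \<union> (\<Union>e\<in>edges G. eset D e)"

definition regions :: "'s topology \<Rightarrow> 'v ugraph \<Rightarrow> ('v, 's) drawing \<Rightarrow> 's set set" where
  "regions X G D = connected_components_of (subtopology X (topspace X - point_set G D))"

definition faces :: "'s topology \<Rightarrow> 'v ugraph \<Rightarrow> ('v, 's) drawing \<Rightarrow> 's set set" where
  "faces X G D = (\<lambda>C. X closure_of C) ` regions X G D"

text \<open>The boundary of a face is the frontier of the open region of which it is the closure;
  removing the graph from a face gives back that region. (The frontier of the closed set itself
  would lose the edges that have the face on both sides.)\<close>

lemma closure_of_region_Diff:
  assumes "C \<in> regions X G D"
  shows "X closure_of C - point_set G D = C"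
proof -
  let ?S = "topspace X - point_set G D"
  have "closedin (subtopology X ?S) C"
    using assms closedin_connected_components_of unfolding regions_def by blast
  then have "?S \<inter> X closure_of C = C" and "C \<subseteq> ?S"
    by (auto simp: closedin_Int_closure_of inf.absorb2 closedin_subset dest: closedin_subset)
  then show ?thesis
    using closure_of_subset_topspace[of X C] by blast
qed

definition face_boundary ::
    "'s topology \<Rightarrow> 'v ugraph \<Rightarrow> ('v, 's) drawing \<Rightarrow> 's set \<Rightarrow> 's set" where
  "face_boundary X G D f = X frontier_of (f - point_set G D)"

definition face_edges ::
    "'s topology \<Rightarrow> 'v ugraph \<Rightarrow> ('v, 's) drawing \<Rightarrow> 's set \<Rightarrow> 'v set set" where
  "face_edges X G D f = {e \<in> edges G. eset D e \<subseteq> face_boundary X G D f}"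

definition even_face ::
    "'s topology \<Rightarrow> 'v ugraph \<Rightarrow> ('v, 's) drawing \<Rightarrow> 's set \<Rightarrow> bool" where
  "even_face X G D f \<longleftrightarrow>
     (\<exists>vs. cycle_in G vs \<and> even (length vs) \<and>
           face_boundary X G D f = (\<Union>e\<in>cycle_edges vs. eset D e))"


section \<open>Resonance graphs\<close>

definition resonance_graph ::
    "'s topology \<Rightarrow> 'v ugraph \<Rightarrow> ('v, 's) drawing \<Rightarrow> 's set set \<Rightarrow> 'v set set ugraph" where
  "resonance_graph X G D \<F> =
     ({M. perfect_matching G M},
      {{M, M'} | M M'. perfect_matching G M \<and> perfect_matching G M' \<and>
                       (\<exists>f\<in>\<F>. sym_diff M M' = face_edges X G D f)})"

definition corresponding_edges ::
    "'s topology \<Rightarrow> 'v ugraph \<Rightarrow> ('v, 's) drawing \<Rightarrow> 'v set set ugraph \<Rightarrow> 's set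
     \<Rightarrow> 'v set set set set" where
  "corresponding_edges X G D H f =
     {{M, M'} | M M'. {M, M'} \<in> edges H \<and> sym_diff M M' = face_edges X G D f}"

text \<open>Only faces of \<open>\<F>\<close> count: a face outside \<open>\<F>\<close> may have the same edge set as one in \<open>\<F>\<close>
  (e.g. when the graph is a cycle in the sphere).\<close>

definition corresponding_faces ::
    "'s topology \<Rightarrow> 'v ugraph \<Rightarrow> ('v, 's) drawing \<Rightarrow> 's set set \<Rightarrow> 'v set set ugraph
     \<Rightarrow> 's set set" where
  "corresponding_faces X G D \<F> H = {f \<in> \<F>. corresponding_edges X G D H f \<noteq> {}}"

definition side_label ::
    "'v ugraph \<Rightarrow> 'v set set \<Rightarrow> 'v set set \<Rightarrow> 'v \<Rightarrow> nat" where
  "side_label H S A x = (if component_of (delete_edges H S) x \<in> A then 0 else 1)"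

end

theory Submission
  imports Defs
begin

text \<open>
  Everything rests on the independence over the two-element field of the edge sets of the faces
  in \<open>\<F>\<close>. Suppose a nonempty finite set \<open>S\<close> of even faces leaves no edge on exactly one face of
  \<open>S\<close>. An edge locally has at most two sides, so near an interior point of an edge on two faces of
  \<open>S\<close> the surface is covered by these two faces. Hence the union of \<open>S\<close> is open and closed in the
  surface without the vertices, which is connected, and \<open>S\<close> consists of all faces.

  Consequently any two matchings \<open>M\<close> and \<open>M'\<close> in \<open>H\<close> determine a unique set \<open>flips M M'\<close> of faces
  whose edge sets sum to the symmetric difference of \<open>M\<close> and \<open>M'\<close>. For a fixed \<open>M\<close>, the edges of
  \<open>H\<close> that correspond to \<open>f\<close> form the cut between the \<open>N\<close> with \<open>f \<in> flips M N\<close> and the others, so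
  \<open>M\<close> and \<open>M'\<close> have different labels at \<open>f\<close> iff \<open>f \<in> flips M M'\<close>.
\<close>

section \<open>Two-sidedness of arcs\<close>

text \<open>At most two sides: \<open>U\<close> and \<open>V\<close> may coincide or be empty.\<close>

definition locally_two_sided :: "'a topology \<Rightarrow> 'a set \<Rightarrow> 'a \<Rightarrow> bool" where
  "locally_two_sided X A x \<longleftrightarrow>
     (\<forall>W. openin X W \<longrightarrow> x \<in> W \<longrightarrow>
        (\<exists>N U V. openin X N \<and> x \<in> N \<and> connectedin X U \<and> connectedin X V \<and>
                 U \<union> V \<subseteq> W - A \<and> N - A \<subseteq> U \<union> V))"

lemma locally_two_sidedI:
  assumes "\<And>W. openin X W \<Longrightarrow> x \<in> W \<Longrightarrow>
    \<exists>N U V. openin X N \<and> x \<in> N \<and> connectedin X U \<and> connectedin X V \<and>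
            U \<union> V \<subseteq> W - A \<and> N - A \<subseteq> U \<union> V"
  shows "locally_two_sided X A x"
  using assms by (simp add: locally_two_sided_def)

lemma locally_two_sidedE:
  assumes "locally_two_sided X A x" "openin X W" "x \<in> W"
  obtains N U V where "openin X N" "x \<in> N" "connectedin X U" "connectedin X V"
    "U \<union> V \<subseteq> W - A" "N - A \<subseteq> U \<union> V"
  using assms unfolding locally_two_sided_def by metis

lemma locally_two_sided_local_cong:
  assumes two_sided: "locally_two_sided X A x"
    and Q: "openin X Q" "x \<in> Q" and agree: "Q \<inter> A = Q \<inter> B"
  shows "locally_two_sided X B x"
proof (rule locally_two_sidedI)
  fix W assume "openin X W" "x \<in> W"
  then have "openin X (W \<inter> Q)" "x \<in> W \<inter> Q"
    using Q by auto
  then obtain N U V where N: "openin X N" "x \<in> N" "N - A \<subseteq> U \<union> V"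
      and UV: "connectedin X U" "connectedin X V" "U \<union> V \<subseteq> W \<inter> Q - A"
    using locally_two_sidedE[OF two_sided] by metis
  have "openin X (N \<inter> Q)" "x \<in> N \<inter> Q"
    using N Q by auto
  moreover have "U \<union> V \<subseteq> W - B" "N \<inter> Q - B \<subseteq> U \<union> V"
    using UV(3) N(3) agree by blast+
  ultimately show "\<exists>N U V. openin X N \<and> x \<in> N \<and> connectedin X U \<and> connectedin X V \<and>
      U \<union> V \<subseteq> W - B \<and> N - B \<subseteq> U \<union> V"
    using UV(1,2) by metis
qed

lemma locally_two_sided_open_map_image:
  assumes \<psi>: "continuous_map Y X \<psi>" "open_map Y X \<psi>" "inj_on \<psi> (topspace Y)"
    and two_sided: "locally_two_sided Y A z" and "z \<in> topspace Y" "A \<subseteq> topspace Y"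
  shows "locally_two_sided X (\<psi> ` A) (\<psi> z)"
proof (rule locally_two_sidedI)
  fix W assume W: "openin X W" "\<psi> z \<in> W"
  define preW where "preW = {y \<in> topspace Y. \<psi> y \<in> W}"
  have "openin Y preW" "z \<in> preW"
    using openin_continuous_map_preimage[OF \<psi>(1) W(1)] W(2) \<open>z \<in> topspace Y\<close>
    by (auto simp: preW_def)
  then obtain N U V where N: "openin Y N" "z \<in> N" "N - A \<subseteq> U \<union> V"
      and UV: "connectedin Y U" "connectedin Y V" "U \<union> V \<subseteq> preW - A"
    using locally_two_sidedE[OF two_sided] by metis
  have "\<psi> ` U \<union> \<psi> ` V \<subseteq> W - \<psi> ` A"
    using UV(3) \<psi>(3) \<open>A \<subseteq> topspace Y\<close> by (auto simp: preW_def dest: inj_onD)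
  moreover have "\<psi> ` N - \<psi> ` A \<subseteq> \<psi> ` U \<union> \<psi> ` V"
    using N(3) by blast
  moreover have "openin X (\<psi> ` N)" "\<psi> z \<in> \<psi> ` N"
    using N(1,2) \<psi>(2) by (auto simp: open_map_def)
  ultimately show "\<exists>N U V. openin X N \<and> \<psi> z \<in> N \<and> connectedin X U \<and> connectedin X V \<and>
      U \<union> V \<subseteq> W - \<psi> ` A \<and> N - \<psi> ` A \<subseteq> U \<union> V"
    using connectedin_continuous_map_image[OF \<psi>(1) UV(1)]
      connectedin_continuous_map_image[OF \<psi>(1) UV(2)] by blast
qed

lemma locally_two_sided_meets_two_components:
  assumes two_sided: "locally_two_sided X A x"
    and comp: "C \<in> connected_components_of (subtopology X (topspace X - A))"
      "C' \<in> connected_components_of (subtopology X (topspace X - A))" "C \<noteq> C'"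
    and closure: "x \<in> X closure_of C" "x \<in> X closure_of C'"
  obtains N where "openin X N" "x \<in> N" "N \<subseteq> C \<union> C' \<union> A"
proof -
  have "x \<in> topspace X"
    using closure(1) by (simp add: in_closure_of)
  then obtain N U V where N: "openin X N" "x \<in> N" "N - A \<subseteq> U \<union> V"
      and UV: "connectedin X U" "connectedin X V" "U \<union> V \<subseteq> topspace X - A"
    by (rule locally_two_sidedE[OF two_sided openin_topspace])
  have side_subset: "(U \<inter> E \<noteq> {} \<and> U \<subseteq> E) \<or> (V \<inter> E \<noteq> {} \<and> V \<subseteq> E)"
    if E: "E \<in> connected_components_of (subtopology X (topspace X - A))" "x \<in> X closure_of E" for E
  proof -
    obtain y where "y \<in> E" "y \<in> N"
      using E(2) N(1,2) unfolding in_closure_of by blast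
    moreover have "E \<inter> A = {}"
      using connected_components_of_subset[OF E(1)] by auto
    ultimately have "U \<inter> E \<noteq> {} \<or> V \<inter> E \<noteq> {}"
      using N(3) by blast
    moreover have "connectedin (subtopology X (topspace X - A)) U"
        "connectedin (subtopology X (topspace X - A)) V"
      using UV by (auto simp: connectedin_subtopology)
    ultimately show ?thesis
      using connected_components_of_maximal[OF E(1)] by (metis disjnt_def inf_commute)
  qed
  have "C \<inter> C' = {}"
    using comp connected_components_of_overlap by blast
  then have "U \<union> V \<subseteq> C \<union> C'"
    using side_subset[OF comp(1) closure(1)] side_subset[OF comp(2) closure(2)] by (elim disjE) blast+
  then show ?thesis
    using that N by blast
qed

lemma first_hitting_time:
  fixes f :: "real \<Rightarrow> real"
  assumes "continuous_on {a..b} f" "a \<le> b" "f a < r" "r \<le> f b"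
  obtains t where "a < t" "t \<le> b" "f t = r" "\<And>y. a \<le> y \<Longrightarrow> y < t \<Longrightarrow> f y < r"
proof -
  define hits where "hits = {t \<in> {a..b}. f t = r}"
  have "hits \<noteq> {}"
    using IVT'[of f a r b] assms by (auto simp: hits_def)
  moreover have "compact hits"
    using continuous_closed_preimage_constant[OF assms(1)]
    unfolding hits_def by (auto simp: compact_eq_bounded_closed intro: bounded_subset[of "{a..b}"])
  ultimately obtain t where t: "t \<in> hits" "\<And>s. s \<in> hits \<Longrightarrow> t \<le> s"
    using compact_attains_inf by metis
  then have "a \<le> t" "t \<le> b" "f t = r"
    by (auto simp: hits_def)
  moreover have "f y < r" if y: "a \<le> y" "y < t" for y
  proof (rule ccontr)
    assume "\<not> f y < r"
    then obtain s where "a \<le> s" "s \<le> y" "f s = r"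
      using IVT'[of f a r y] y \<open>t \<le> b\<close> assms(1,3) continuous_on_subset[of "{a..b}" f "{a..y}"]
      by auto
    then have "s \<in> hits"
      using y \<open>t \<le> b\<close> by (auto simp: hits_def)
    then show False
      using t(2)[of s] \<open>s \<le> y\<close> y by simp
  qed
  moreover have "t \<noteq> a"
    using \<open>f t = r\<close> assms(3) by auto
  ultimately show ?thesis
    using that by force
qed

lemma crosscut_subinterval:
  fixes g :: "real \<Rightarrow> 'a::metric_space"
  assumes cont: "continuous_on {a..b} g" and between: "a < c" "c < b" and "0 < r"
    and ends: "g a \<notin> ball (g c) r" "g b \<notin> ball (g c) r"
  obtains s t where "a \<le> s" "s < c" "c < t" "t \<le> b" "g s \<in> sphere (g c) r" "g t \<in> sphere (g c) r"
    "\<And>y. s < y \<Longrightarrow> y < t \<Longrightarrow> g y \<in> ball (g c) r"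
proof -
  obtain t where t: "c < t" "t \<le> b" "dist (g c) (g t) = r"
      "\<And>y. c \<le> y \<Longrightarrow> y < t \<Longrightarrow> dist (g c) (g y) < r"
  proof (rule first_hitting_time[of c b "\<lambda>y. dist (g c) (g y)" r])
    show "continuous_on {c..b} (\<lambda>y. dist (g c) (g y))"
      using between by (intro continuous_intros continuous_on_subset[OF cont]) auto
  qed (use between \<open>0 < r\<close> ends in auto)
  obtain s where s: "- c < s" "s \<le> - a" "dist (g c) (g (- s)) = r"
      "\<And>y. - c \<le> y \<Longrightarrow> y < s \<Longrightarrow> dist (g c) (g (- y)) < r"
  proof (rule first_hitting_time[of "- c" "- a" "\<lambda>y. dist (g c) (g (- y))" r])
    have "continuous_on {- c..- a} (\<lambda>y. g (- y))"
      using between by (intro continuous_on_compose2[OF cont] continuous_intros) auto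
    then show "continuous_on {- c..- a} (\<lambda>y. dist (g c) (g (- y)))"
      by (intro continuous_intros)
  qed (use between \<open>0 < r\<close> ends in auto)
  have "g y \<in> ball (g c) r" if "- s < y" "y < t" for y
    using t(4)[of y] s(4)[of "- y"] that by (cases "c \<le> y") auto
  then show ?thesis
    using that[of "- s" t] s(1-3) t(1-3) by auto
qed

lemma arc_subpath_inj_on:
  fixes g :: "real \<Rightarrow> 'a::real_normed_vector"
  assumes cont: "continuous_on {s..t} g" and inj: "inj_on g {s..t}" and "s < t"
  shows "arc (subpath s t g)"
  unfolding arc_def path_def
proof
  have inside: "(t - s) * u + s \<in> {s..t}" if "u \<in> {0..1}" for u
  proof -
    have "0 \<le> (t - s) * u" "(t - s) * u \<le> t - s"
      using that \<open>s < t\<close> by (auto intro: mult_left_le)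
    then show ?thesis
      by simp
  qed
  then show "continuous_on {0..1} (subpath s t g)"
    unfolding subpath_def by (intro continuous_on_compose2[OF cont] continuous_intros) auto
  show "inj_on (subpath s t g) {0..1}"
  proof (rule inj_onI)
    fix u v assume "u \<in> {0..1}" "v \<in> {0..1}" "subpath s t g u = subpath s t g v"
    then have "(t - s) * u + s = (t - s) * v + s"
      using inside by (intro inj_onD[OF inj]) (auto simp: subpath_def)
    then show "u = v"
      using \<open>s < t\<close> by simp
  qed
qed

lemma crosscut_closed_by_circular_arc:
  fixes h :: "real \<Rightarrow> complex"
  assumes "arc h" "0 < r"
    and ends: "pathstart h \<in> sphere x r" "pathfinish h \<in> sphere x r"
    and interior: "path_image h - {pathstart h, pathfinish h} \<subseteq> ball x r"
  obtains u where "arc u" "path_image u \<subseteq> sphere x r" "simple_path (h +++ u)"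
    "pathstart u = pathfinish h" "pathfinish u = pathstart h"
proof -
  have "path_connected (sphere x r)"
    by (rule path_connected_sphere) simp
  then obtain u where u: "arc u" "path_image u \<subseteq> sphere x r"
      "pathstart u = pathfinish h" "pathfinish u = pathstart h"
    unfolding path_connected_arcwise using ends arc_distinct_ends[OF \<open>arc h\<close>] by metis
  have "path_image h \<inter> path_image u \<subseteq> {pathstart h, pathstart u}"
    using interior u(2,3) by fastforce
  then have "simple_path (h +++ u)"
    using \<open>arc h\<close> u by (intro simple_path_join_loop) auto
  then show ?thesis
    using that u by blast
qed

lemma connected_superset_if_pairwise_connected_component:
  assumes "\<And>p q. p \<in> A \<Longrightarrow> q \<in> A \<Longrightarrow> connected_component S p q"
  obtains U where "connected U" "A \<subseteq> U" "U \<subseteq> S"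
proof (cases "A = {}")
  case True
  then show ?thesis
    using that[of "{}"] by simp
next
  case False
  then obtain p where "p \<in> A"
    by blast
  then have "A \<subseteq> connected_component_set S p"
    using assms by blast
  then show ?thesis
    using that[of "connected_component_set S p"] connected_component_subset by auto
qed

lemma Janiszewski_joined_in_disc:
  fixes J L side :: "complex set"
  assumes "compact J" "closed L" and connected_Int: "connected (J \<inter> (L \<union> - ball x r))"
    and small: "ball x \<delta> \<inter> L = {}" "\<delta> \<le> r"
    and side: "connected side" "side \<subseteq> - J"
  obtains U where "connected U" "ball x \<delta> \<inter> side \<subseteq> U" "U \<subseteq> ball x r - (J \<union> L)"
proof (rule connected_superset_if_pairwise_connected_component)
  fix p q assume pq: "p \<in> ball x \<delta> \<inter> side" "q \<in> ball x \<delta> \<inter> side"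
  have "connected_component (- (J \<union> (L \<union> - ball x r))) p q"
  proof (rule Janiszewski)
    show "closed (L \<union> - ball x r)"
      using \<open>closed L\<close> by auto
    show "connected_component (- J) p q"
      using side pq by (intro connected_componentI[of side]) auto
    show "connected_component (- (L \<union> - ball x r)) p q"
      using pq small by (intro connected_componentI[of "ball x \<delta>"]) auto
  qed (fact assms(1,3))+
  then show "connected_component (ball x r - (J \<union> L)) p q"
    by (rule connected_component_of_subset) auto
qed

text \<open>The set \<open>L\<close> stands for the pieces of an arc outside its crosscut \<open>h\<close>, which may re-enter the
  disc. Close \<open>h\<close> to a Jordan curve \<open>J\<close> by an arc \<open>u\<close> of the circle; then \<open>J\<close> meets \<open>L\<close> together
  with the exterior of the disc only in the connected set \<open>u\<close>, so by Janiszewski's theorem the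
  points near \<open>x\<close> on one side of \<open>J\<close> can be joined in the disc off both \<open>h\<close> and \<open>L\<close>.\<close>

lemma crosscut_two_sides:
  fixes h :: "real \<Rightarrow> complex"
  assumes "arc h" "0 < r"
    and ends: "pathstart h \<in> sphere x r" "pathfinish h \<in> sphere x r"
    and interior: "path_image h - {pathstart h, pathfinish h} \<subseteq> ball x r"
    and "closed L" and h_Int_L: "path_image h \<inter> L \<subseteq> {pathstart h, pathfinish h}"
    and small: "ball x \<delta> \<inter> L = {}" "\<delta> \<le> r"
  obtains U V where "connected U" "connected V" "U \<union> V \<subseteq> ball x r - (path_image h \<union> L)"
    "ball x \<delta> - path_image h \<subseteq> U \<union> V"
proof -
  obtain u where u: "arc u" "path_image u \<subseteq> sphere x r" "simple_path (h +++ u)"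
      "pathstart u = pathfinish h" "pathfinish u = pathstart h"
    using crosscut_closed_by_circular_arc[OF assms(1-5)] .
  define J where "J = path_image (h +++ u)"
  have J_eq: "J = path_image h \<union> path_image u"
    using u(4) by (simp add: J_def path_image_join)
  have Jordan: "connected (inside J)" "connected (outside J)" "inside J \<union> outside J = - J"
    using Jordan_inside_outside[OF u(3)] u(4,5) by (auto simp: J_def)
  have "compact J"
    using u(3) by (simp add: J_def compact_simple_path_image)
  have "pathstart h \<in> path_image u" "pathfinish h \<in> path_image u"
    using u(4,5) by (metis pathstart_in_path_image pathfinish_in_path_image)+
  then have "J \<inter> (L \<union> - ball x r) = path_image u"
    using interior h_Int_L u(2) by (fastforce simp: J_eq)
  then have connected_Int: "connected (J \<inter> (L \<union> - ball x r))"
    using u(1) by (simp add: arc_imp_path connected_path_image)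
  note joined = Janiszewski_joined_in_disc[OF \<open>compact J\<close> \<open>closed L\<close> connected_Int small]
  obtain U where U: "connected U" "ball x \<delta> \<inter> inside J \<subseteq> U" "U \<subseteq> ball x r - (J \<union> L)"
    using joined[OF Jordan(1)] Jordan(3) by blast
  obtain V where V: "connected V" "ball x \<delta> \<inter> outside J \<subseteq> V" "V \<subseteq> ball x r - (J \<union> L)"
    using joined[OF Jordan(2)] Jordan(3) by blast
  have "ball x \<delta> - path_image h \<subseteq> inside J \<union> outside J"
    unfolding Jordan(3) using u(2) small(2) by (auto simp: J_eq)
  then have "ball x \<delta> - path_image h \<subseteq> U \<union> V"
    using U(2) V(2) by blast
  moreover have "U \<union> V \<subseteq> ball x r - (path_image h \<union> L)"
    using U(3) V(3) by (auto simp: J_eq)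
  ultimately show ?thesis
    using that[OF U(1) V(1)] by simp
qed

lemma planar_arc_two_sides_at_crosscut:
  fixes g :: "real \<Rightarrow> complex"
  assumes cont: "continuous_on {a..b} g" and inj: "inj_on g {a..b}"
    and st: "a \<le> s" "s < c" "c < t" "t \<le> b" and "0 < r"
    and on_circle: "g s \<in> sphere (g c) r" "g t \<in> sphere (g c) r"
    and in_disc: "\<And>y. s < y \<Longrightarrow> y < t \<Longrightarrow> g y \<in> ball (g c) r"
  obtains U V \<delta> where "connected U" "connected V" "U \<union> V \<subseteq> ball (g c) r - g ` {a..b}"
    "0 < \<delta>" "ball (g c) \<delta> - g ` {a..b} \<subseteq> U \<union> V"
proof -
  define h where "h = subpath s t g"
  define L where "L = g ` ({a..s} \<union> {t..b})"
  have h_image: "path_image h = g ` {s..t}"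
    using st by (simp add: h_def path_image_subpath)
  have ends: "pathstart h = g s" "pathfinish h = g t"
    by (auto simp: h_def)
  have "arc h"
    unfolding h_def using st
    by (intro arc_subpath_inj_on continuous_on_subset[OF cont] inj_on_subset[OF inj]) auto
  have "closed L"
    unfolding L_def using st
    by (intro compact_imp_closed compact_continuous_image continuous_on_subset[OF cont]) auto
  have "g c \<notin> L"
    using st by (auto simp: L_def inj_on_eq_iff[OF inj])
  then obtain e where e: "0 < e" "ball (g c) e \<subseteq> - L"
    using \<open>closed L\<close> by (meson ComplI open_Compl openE)
  have h_interior: "path_image h - {pathstart h, pathfinish h} \<subseteq> ball (g c) r"
    using in_disc by (force simp: h_image ends)
  have h_Int_L: "path_image h \<inter> L \<subseteq> {pathstart h, pathfinish h}"
    using st by (auto simp: h_image ends L_def inj_on_eq_iff[OF inj])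
  obtain U V where UV: "connected U" "connected V"
      "U \<union> V \<subseteq> ball (g c) r - (path_image h \<union> L)"
      "ball (g c) (min e r) - path_image h \<subseteq> U \<union> V"
    by (rule crosscut_two_sides[OF \<open>arc h\<close> \<open>0 < r\<close> _ _ h_interior \<open>closed L\<close> h_Int_L, of "min e r"])
      (use on_circle e(2) in \<open>auto simp: ends\<close>)
  have "{a..b} = {s..t} \<union> ({a..s} \<union> {t..b})"
    using st by auto
  then have "g ` {a..b} = path_image h \<union> L"
    by (metis h_image L_def image_Un)
  then show ?thesis
    using that[of U V "min e r"] UV e(1) \<open>0 < r\<close> by auto
qed

lemma planar_arc_locally_two_sided:
  fixes g :: "real \<Rightarrow> complex"
  assumes cont: "continuous_on {a..b} g" and inj: "inj_on g {a..b}" and between: "a < c" "c < b"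
  shows "locally_two_sided euclidean (g ` {a..b}) (g c)"
proof (rule locally_two_sidedI)
  fix W assume "openin euclidean W" "g c \<in> W"
  then have "open (W - {g a, g b})" "g c \<in> W - {g a, g b}"
    using between by (auto simp: inj_on_eq_iff[OF inj] intro: open_Diff)
  then obtain r where r: "0 < r" "ball (g c) r \<subseteq> W - {g a, g b}"
    by (rule openE)
  obtain s t where "a \<le> s" "s < c" "c < t" "t \<le> b"
      and "g s \<in> sphere (g c) r" "g t \<in> sphere (g c) r"
      and "\<And>y. s < y \<Longrightarrow> y < t \<Longrightarrow> g y \<in> ball (g c) r"
    using crosscut_subinterval[OF cont between r(1)] r(2) by blast
  then obtain U V \<delta> where UV: "connected U" "connected V" "U \<union> V \<subseteq> ball (g c) r - g ` {a..b}"
      "0 < \<delta>" "ball (g c) \<delta> - g ` {a..b} \<subseteq> U \<union> V"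
    using planar_arc_two_sides_at_crosscut[OF cont inj _ _ _ _ r(1)] by metis
  then have "U \<union> V \<subseteq> W - g ` {a..b}" "openin euclidean (ball (g c) \<delta>)" "g c \<in> ball (g c) \<delta>"
    using r(2) by auto
  then show "\<exists>N U V. openin euclidean N \<and> g c \<in> N \<and> connectedin euclidean U \<and>
      connectedin euclidean V \<and> U \<union> V \<subseteq> W - g ` {a..b} \<and> N - g ` {a..b} \<subseteq> U \<union> V"
    using UV by (metis connectedin_iff_connected)
qed

section \<open>Closed surfaces\<close>

lemma homeomorphic_imp_homeomorphic_space:
  assumes "S homeomorphic T"
  shows "top_of_set S homeomorphic_space top_of_set T"
proof -
  obtain f g where "homeomorphism S T f g"
    using assms by (auto simp: homeomorphic_def)
  then have "homeomorphic_maps (top_of_set S) (top_of_set T) f g"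
    by (auto simp: homeomorphism_def homeomorphic_maps_def)
  then show ?thesis
    by (auto simp: homeomorphic_space_def)
qed

lemma closedin_continuous_image_compact:
  assumes "Hausdorff_space X" "continuous_map (top_of_set S) X \<gamma>" "compact K" "K \<subseteq> S"
  shows "closedin X (\<gamma> ` K)"
proof -
  have "compactin (top_of_set S) K"
    using assms(3,4) by (simp add: compactin_subtopology)
  then show ?thesis
    using assms(1,2) by (blast intro: compactin_imp_closedin image_compactin)
qed

lemma closed_surface_chart:
  assumes "closed_surface X" "x \<in> topspace X"
  obtains U \<phi> and \<psi> :: "complex \<Rightarrow> 's" where "openin X U" "x \<in> U"
    "homeomorphic_maps (subtopology X U) euclidean \<phi> \<psi>"
proof -
  obtain U where U: "openin X U" "x \<in> U"
      "subtopology X U homeomorphic_space (euclidean :: (real ^ 2) topology)"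
    using assms unfolding closed_surface_def by blast
  have "(euclidean :: (real ^ 2) topology) homeomorphic_space (euclidean :: complex topology)"
    using homeomorphic_imp_homeomorphic_space[of "UNIV :: (real ^ 2) set" "UNIV :: complex set"]
    by (simp add: homeomorphic_UNIV_UNIV)
  with U(3) have "subtopology X U homeomorphic_space (euclidean :: complex topology)"
    by (rule homeomorphic_space_trans)
  then show ?thesis
    using that[OF U(1,2)] by (auto simp: homeomorphic_space_def)
qed

lemma homeomorphic_maps_open_subtopology_inverse:
  assumes "homeomorphic_maps (subtopology X U) Y \<phi> \<psi>" "openin X U"
  shows "continuous_map Y X \<psi>" "open_map Y X \<psi>" "inj_on \<psi> (topspace Y)"
proof -
  have \<psi>: "homeomorphic_map Y (subtopology X U) \<psi>"
    using assms(1) homeomorphic_maps_map by blast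
  show "continuous_map Y X \<psi>"
    using \<psi> homeomorphic_imp_continuous_map continuous_map_into_fulltopology by blast
  show "open_map Y X \<psi>"
    using homeomorphic_imp_open_map[OF \<psi>] openin_trans_full[OF _ assms(2)]
    by (auto simp: open_map_def)
  show "inj_on \<psi> (topspace Y)"
    using \<psi> by (rule homeomorphic_imp_injective_map)
qed

lemma closed_surface_disc_neighbourhood:
  assumes surface: "closed_surface X" and W: "openin X W" "x \<in> W"
  obtains B where "openin X B" "x \<in> B" "B \<subseteq> W" "connectedin X B" "connectedin X (B - {x})"
proof -
  have "x \<in> topspace X"
    using W openin_subset by blast
  then obtain U \<phi> and \<psi> :: "complex \<Rightarrow> 'a" where U: "openin X U" "x \<in> U"
      and chart: "homeomorphic_maps (subtopology X U) euclidean \<phi> \<psi>"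
    by (rule closed_surface_chart[OF surface])
  note \<psi> = homeomorphic_maps_open_subtopology_inverse[OF chart U(1)]
  define z where "z = \<phi> x"
  have "\<psi> z = x"
    using chart U(2) \<open>x \<in> topspace X\<close> by (simp add: homeomorphic_maps_def z_def)
  have "open {w. \<psi> w \<in> W}" "z \<in> {w. \<psi> w \<in> W}"
    using openin_continuous_map_preimage[OF \<psi>(1) W(1)] W(2) \<open>\<psi> z = x\<close> by auto
  then obtain r where r: "0 < r" "ball z r \<subseteq> {w. \<psi> w \<in> W}"
    by (rule openE)
  define B where "B = \<psi> ` ball z r"
  have "B - {x} = \<psi> ` (ball z r - {z})"
    using \<psi>(3) \<open>\<psi> z = x\<close> by (auto simp: B_def dest: injD)
  then have "connectedin X B" "connectedin X (B - {x})"
    using connectedin_continuous_map_image[OF \<psi>(1)] connected_punctured_ball[of z r]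
    by (auto simp: B_def)
  moreover have "openin X B"
    using \<psi>(2) by (auto simp: B_def open_map_def)
  moreover have "x \<in> B" "B \<subseteq> W"
    using r \<open>\<psi> z = x\<close> by (auto simp: B_def)
  ultimately show ?thesis
    using that by blast
qed

lemma closed_surface_imp_locally_connected_space:
  assumes "closed_surface X"
  shows "locally_connected_space X"
  unfolding locally_connected_space
  using closed_surface_disc_neighbourhood[OF assms] by metis

lemma connectedin_delete_point:
  assumes Y: "connectedin X Y" "openin X (Y - {v})"
    and B: "openin X B" "v \<in> B" "B \<subseteq> Y" "connectedin X (B - {v})"
  shows "connectedin X (Y - {v})"
proof (rule ccontr)
  have not_separated: "\<not> (Y - {v} \<subseteq> E \<union> E' \<and> E \<inter> E' \<inter> (Y - {v}) = {} \<and>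
      E' \<inter> (Y - {v}) \<noteq> {} \<and> E' \<inter> (B - {v}) = {})"
    if E: "openin X E" "openin X E'" for E E'
  proof
    assume sep: "Y - {v} \<subseteq> E \<union> E' \<and> E \<inter> E' \<inter> (Y - {v}) = {} \<and>
      E' \<inter> (Y - {v}) \<noteq> {} \<and> E' \<inter> (B - {v}) = {}"
    define F F' where "F = E \<inter> (Y - {v}) \<union> B" and "F' = E' \<inter> (Y - {v})"
    have "openin X F" "openin X F'"
      unfolding F_def F'_def using E Y(2) B(1) by auto
    moreover have "Y \<subseteq> F \<union> F'" "F \<inter> F' \<inter> Y = {}" "F \<inter> Y \<noteq> {}" "F' \<inter> Y \<noteq> {}"
      unfolding F_def F'_def using sep B(2,3) by blast+
    ultimately show False
      using Y(1) unfolding connectedin by blast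
  qed
  assume "\<not> connectedin X (Y - {v})"
  then obtain E E' where E: "openin X E" "openin X E'" "Y - {v} \<subseteq> E \<union> E'"
      "E \<inter> E' \<inter> (Y - {v}) = {}" "E \<inter> (Y - {v}) \<noteq> {}" "E' \<inter> (Y - {v}) \<noteq> {}"
    using connectedin_subset_topspace[OF Y(1)] unfolding connectedin by blast
  moreover from this have "B - {v} \<subseteq> E \<union> E'" "E \<inter> E' \<inter> (B - {v}) = {}"
    using B(3) by blast+
  ultimately have "E \<inter> (B - {v}) = {} \<or> E' \<inter> (B - {v}) = {}"
    using B(4) unfolding connectedin by metis
  then show False
    using not_separated[of E E'] not_separated[of E' E] E by blast
qed

lemma connectedin_closed_surface_Diff_finite:
  assumes surface: "closed_surface X" and "finite V"
  shows "connectedin X (topspace X - V)"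
  using \<open>finite V\<close>
proof (induction V rule: finite_induct)
  case empty
  then show ?case
    using surface by (simp add: closed_surface_def connectedin_topspace)
next
  case (insert v V)
  have open_Diff_finite: "openin X (topspace X - W)" if "finite W" for W
    using that surface closedin_Hausdorff_finite[of X "topspace X \<inter> W"]
    by (simp add: closed_surface_def openin_closedin_eq double_diff Int_commute Diff_Diff_Int)
  have Diff_insert: "topspace X - insert v V = topspace X - V - {v}"
    by blast
  show ?case
  proof (cases "v \<in> topspace X")
    case True
    then obtain B where "openin X B" "v \<in> B" "B \<subseteq> topspace X - V" "connectedin X (B - {v})"
      using closed_surface_disc_neighbourhood[OF surface open_Diff_finite] insert.hyps by (metis DiffI)
    moreover have "openin X (topspace X - V - {v})"
      using open_Diff_finite[of "insert v V"] insert.hyps(1) by (simp add: Diff_insert)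
    ultimately have "connectedin X (topspace X - V - {v})"
      using connectedin_delete_point[OF insert.IH] by blast
    then show ?thesis
      by (simp add: Diff_insert)
  next
    case False
    then show ?thesis
      using insert.IH by (simp add: Diff_insert Diff_insert0)
  qed
qed

lemma continuous_map_subinterval_into_open:
  fixes c :: real
  assumes \<gamma>: "continuous_map (top_of_set {l..u}) X \<gamma>" and between: "l < c" "c < u"
    and U: "openin X U" "\<gamma> c \<in> U"
  obtains a b where "l \<le> a" "a < c" "c < b" "b \<le> u" "\<gamma> ` {a..b} \<subseteq> U"
proof -
  define I where "I = {t \<in> {l..u}. \<gamma> t \<in> U}"
  have "openin (top_of_set {l..u}) I" "c \<in> I"
    using openin_continuous_map_preimage[OF \<gamma> U(1)] between U(2) by (simp_all add: I_def)
  then obtain e where e: "0 < e" "ball c e \<inter> {l..u} \<subseteq> I"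
    by (meson openin_contains_ball)
  have "{max l (c - e / 2)..min u (c + e / 2)} \<subseteq> ball c e \<inter> {l..u}"
    using \<open>0 < e\<close> by (auto simp: dist_real_def)
  then show ?thesis
    using e between by (intro that[of "max l (c - e / 2)" "min u (c + e / 2)"]) (auto simp: I_def)
qed

lemma arc_in_planar_chart_locally_two_sided:
  fixes \<psi> :: "complex \<Rightarrow> 's" and \<gamma> :: "real \<Rightarrow> 's"
  assumes chart: "homeomorphic_maps (subtopology X U) euclidean \<phi> \<psi>" and U: "openin X U"
    and \<gamma>: "continuous_map (top_of_set {a..b}) X \<gamma>" "inj_on \<gamma> {a..b}" "\<gamma> ` {a..b} \<subseteq> U"
    and between: "a < c" "c < b"
  shows "locally_two_sided X (\<gamma> ` {a..b}) (\<gamma> c)"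
proof -
  have \<psi>\<phi>: "\<psi> (\<phi> (\<gamma> t)) = \<gamma> t" if "t \<in> {a..b}" for t
  proof -
    have "\<gamma> t \<in> topspace X \<inter> U"
      using that \<gamma>(3) openin_subset[OF U] by blast
    then show ?thesis
      using chart by (simp add: homeomorphic_maps_def)
  qed
  have "locally_two_sided euclidean ((\<phi> \<circ> \<gamma>) ` {a..b}) ((\<phi> \<circ> \<gamma>) c)"
  proof (rule planar_arc_locally_two_sided)
    have "continuous_map (top_of_set {a..b}) (subtopology X U) \<gamma>"
      using \<gamma>(1,3) by (auto simp: continuous_map_in_subtopology)
    moreover have "continuous_map (subtopology X U) euclidean \<phi>"
      using chart by (simp add: homeomorphic_maps_def)
    ultimately have "continuous_map (top_of_set {a..b}) euclidean (\<phi> \<circ> \<gamma>)"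
      by (rule continuous_map_compose)
    then show "continuous_on {a..b} (\<phi> \<circ> \<gamma>)"
      by simp
    show "inj_on (\<phi> \<circ> \<gamma>) {a..b}"
    proof (rule inj_onI)
      fix t t' assume t: "t \<in> {a..b}" "t' \<in> {a..b}" "(\<phi> \<circ> \<gamma>) t = (\<phi> \<circ> \<gamma>) t'"
      then have "\<psi> (\<phi> (\<gamma> t)) = \<psi> (\<phi> (\<gamma> t'))"
        by simp
      then have "\<gamma> t = \<gamma> t'"
        unfolding \<psi>\<phi>[OF t(1)] \<psi>\<phi>[OF t(2)] .
      then show "t = t'"
        using inj_on_eq_iff[OF \<gamma>(2) t(1,2)] by simp
    qed
  qed (use between in auto)
  then have "locally_two_sided X (\<psi> ` (\<phi> \<circ> \<gamma>) ` {a..b}) (\<psi> ((\<phi> \<circ> \<gamma>) c))"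
    using locally_two_sided_open_map_image homeomorphic_maps_open_subtopology_inverse[OF chart U]
    by (metis UNIV_I subset_UNIV topspace_euclidean)
  then show ?thesis
    using \<psi>\<phi> between by (simp add: image_image)
qed

lemma embedded_arc_locally_two_sided:
  assumes surface: "closed_surface X"
    and embedding: "embedding_map (top_of_set {0..1::real}) X \<gamma>" and between: "0 < c" "c < 1"
  shows "locally_two_sided X (\<gamma> ` {0..1}) (\<gamma> c)"
proof -
  have \<gamma>: "continuous_map (top_of_set {0..1}) X \<gamma>" "inj_on \<gamma> {0..1}"
    using embedding by (auto simp: embedding_map_def dest: homeomorphic_imp_continuous_map
        continuous_map_into_fulltopology homeomorphic_imp_injective_map)
  have \<gamma>c: "\<gamma> c \<in> topspace X"
    using continuous_map_image_subset_topspace[OF \<gamma>(1)] between by auto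
  obtain U \<phi> and \<psi> :: "complex \<Rightarrow> 'a" where U: "openin X U" "\<gamma> c \<in> U"
      and chart: "homeomorphic_maps (subtopology X U) euclidean \<phi> \<psi>"
    using closed_surface_chart[OF surface \<gamma>c] .
  obtain a b where ab: "0 \<le> a" "a < c" "c < b" "b \<le> 1" "\<gamma> ` {a..b} \<subseteq> U"
    using continuous_map_subinterval_into_open[OF \<gamma>(1) between U] .
  have unit_interval: "{0..1} = {a..b} \<union> ({0..a} \<union> {b..1})"
    using ab by auto
  define Q where "Q = topspace X - \<gamma> ` ({0..a} \<union> {b..1})"
  show ?thesis
  proof (rule locally_two_sided_local_cong)
    show "locally_two_sided X (\<gamma> ` {a..b}) (\<gamma> c)"
      using ab \<gamma> by (intro arc_in_planar_chart_locally_two_sided[OF chart U(1)]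
          continuous_map_from_subtopology_mono[OF \<gamma>(1)] inj_on_subset[OF \<gamma>(2)]) auto
    show "openin X Q"
      using ab surface unfolding Q_def
      by (intro openin_diff closedin_continuous_image_compact[OF _ \<gamma>(1)])
        (auto simp: closed_surface_def)
    show "\<gamma> c \<in> Q"
      using \<gamma>c ab between by (auto simp: Q_def inj_on_eq_iff[OF \<gamma>(2)])
    show "Q \<inter> \<gamma> ` {a..b} = Q \<inter> \<gamma> ` {0..1}"
      unfolding unit_interval Q_def by blast
  qed
qed

section \<open>Sums of sets modulo two\<close>

definition parity_sum :: "('f \<Rightarrow> 'e set) \<Rightarrow> 'f set \<Rightarrow> 'e set" where
  "parity_sum E S = {e. odd (card {f \<in> S. e \<in> E f})}"

definition parity_independent :: "('f \<Rightarrow> 'e set) \<Rightarrow> 'f set \<Rightarrow> bool" where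
  "parity_independent E F \<longleftrightarrow> (\<forall>S. finite S \<and> S \<subseteq> F \<and> parity_sum E S = {} \<longrightarrow> S = {})"

definition no_private_element :: "('f \<Rightarrow> 'e set) \<Rightarrow> 'f set \<Rightarrow> bool" where
  "no_private_element E S \<longleftrightarrow> (\<forall>f\<in>S. \<forall>e\<in>E f. \<exists>g\<in>S - {f}. e \<in> E g)"

lemma parity_sum_empty [simp]: "parity_sum E {} = {}"
  by (simp add: parity_sum_def)

lemma parity_sum_singleton [simp]: "parity_sum E {f} = E f"
proof -
  have "{g \<in> {f}. e \<in> E g} = (if e \<in> E f then {f} else {})" for e
    by auto
  then show ?thesis
    by (auto simp: parity_sum_def)
qed

lemma odd_card_sym_diff:
  assumes "finite A" "finite B"
  shows "odd (card (sym_diff A B)) \<longleftrightarrow> odd (card A) \<noteq> odd (card B)"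
proof -
  have "card A = card (A - B) + card (A \<inter> B)" "card B = card (B - A) + card (B \<inter> A)"
    using assms by (auto simp: card_Diff_subset_Int card_mono)
  moreover have "card (sym_diff A B) = card (A - B) + card (B - A)"
    using assms by (intro card_Un_disjoint) auto
  ultimately show ?thesis
    by (auto simp: Int_commute)
qed

lemma parity_sum_sym_diff:
  assumes "finite S" "finite T"
  shows "parity_sum E (sym_diff S T) = sym_diff (parity_sum E S) (parity_sum E T)"
proof -
  have "{f \<in> sym_diff S T. e \<in> E f} = sym_diff {f \<in> S. e \<in> E f} {f \<in> T. e \<in> E f}" for e
    by auto
  then have "e \<in> parity_sum E (sym_diff S T) \<longleftrightarrow> (e \<in> parity_sum E S) \<noteq> (e \<in> parity_sum E T)" for e
    using assms odd_card_sym_diff[of "{f \<in> S. e \<in> E f}" "{f \<in> T. e \<in> E f}"]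
    by (simp add: parity_sum_def)
  then show ?thesis
    by blast
qed

lemma no_private_element_if_parity_sum_empty:
  assumes "parity_sum E S = {}"
  shows "no_private_element E S"
  unfolding no_private_element_def
proof (intro ballI, rule ccontr)
  fix f e assume "f \<in> S" "e \<in> E f" "\<not> (\<exists>g\<in>S - {f}. e \<in> E g)"
  then have "{g \<in> S. e \<in> E g} = {f}"
    by blast
  then have "e \<in> parity_sum E S"
    by (simp add: parity_sum_def)
  then show False
    using assms by simp
qed

lemma parity_independent_subset:
  "parity_independent E F \<Longrightarrow> F' \<subseteq> F \<Longrightarrow> parity_independent E F'"
  unfolding parity_independent_def by blast

lemma parity_sum_inject:
  assumes "parity_independent E F" and S: "finite S" "S \<subseteq> F" and T: "finite T" "T \<subseteq> F"
    and "parity_sum E S = parity_sum E T"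
  shows "S = T"
proof -
  have "parity_sum E (sym_diff S T) = {}"
    using assms by (simp add: parity_sum_sym_diff)
  then have "sym_diff S T = {}"
    using assms(1) S T unfolding parity_independent_def by (metis Diff_subset Un_least finite_Diff
        finite_UnI subset_trans)
  then show ?thesis
    by blast
qed

section \<open>Faces of an embedded graph\<close>

locale embedded_graph =
  fixes X :: "'s topology" and G :: "'v ugraph" and D :: "('v, 's) drawing"
  assumes surface: "closed_surface X"
    and simple: "finite_simple_graph G"
    and embedded: "embedded_in X G D"
begin

abbreviation vertex_points :: "'s set" where
  "vertex_points \<equiv> vpoint D ` verts G"

abbreviation open_edge :: "'v set \<Rightarrow> 's set" where
  "open_edge e \<equiv> ecurve D e ` {0<..<1}"

definition face_region :: "'s set \<Rightarrow> 's set" where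
  "face_region f = f - point_set G D"

lemma Hausdorff: "Hausdorff_space X"
  using surface by (simp add: closed_surface_def)

lemma finite_edges: "finite (edges G)"
  using simple finite_subset[of "edges G" "Pow (verts G)"] by (auto simp: finite_simple_graph_def)

lemma finite_vertex_points: "finite vertex_points"
  using simple by (simp add: finite_simple_graph_def)

lemma closedin_vertex_points: "closedin X vertex_points"
  using closedin_Hausdorff_finite[OF Hausdorff _ finite_vertex_points] embedded
  by (simp add: embedded_in_def)

lemma vpoint_image_subset_vertex_points: "e \<in> edges G \<Longrightarrow> vpoint D ` e \<subseteq> vertex_points"
  using simple by (auto simp: finite_simple_graph_def)

lemma eset_eq:
  assumes "e \<in> edges G"
  shows "eset D e = open_edge e \<union> vpoint D ` e"
proof -
  have "{0..1::real} = {0<..<1} \<union> {0, 1}"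
    by auto
  then have "eset D e = open_edge e \<union> {ecurve D e 0, ecurve D e 1}"
    unfolding eset_def by (simp only: image_Un image_insert image_empty)
  moreover have "{ecurve D e 0, ecurve D e 1} = vpoint D ` e"
    using embedded assms by (simp add: embedded_in_def)
  ultimately show ?thesis
    by (simp only:)
qed

lemma open_edge_Int_vertex_points: "e \<in> edges G \<Longrightarrow> open_edge e \<inter> vertex_points = {}"
  using embedded by (simp add: embedded_in_def)

lemma open_edge_Int_point_set_delete_edge:
  assumes e: "e \<in> edges G"
  shows "open_edge e \<inter> point_set (delete_edges G {e}) D = {}"
proof -
  have "open_edge e \<inter> eset D e' = {}" if e': "e' \<in> edges G" "e \<noteq> e'" for e'
  proof -
    have "open_edge e \<inter> open_edge e' = {}"
      using embedded e e' by (simp add: embedded_in_def)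
    moreover have "open_edge e \<inter> vpoint D ` e' = {}"
      using open_edge_Int_vertex_points[OF e] vpoint_image_subset_vertex_points[OF e'(1)] by blast
    ultimately show ?thesis
      unfolding eset_eq[OF e'(1)] by blast
  qed
  then show ?thesis
    using open_edge_Int_vertex_points[OF e] by (auto simp: point_set_def delete_edges_def)
qed

lemma point_set_eq_eset_Un_delete_edge:
  "e \<in> edges G \<Longrightarrow> point_set G D = eset D e \<union> point_set (delete_edges G {e}) D"
  by (auto simp: point_set_def delete_edges_def)

lemma embedding_map_ecurve: "e \<in> edges G \<Longrightarrow> embedding_map (top_of_set {0..1}) X (ecurve D e)"
  using embedded by (simp add: embedded_in_def)

lemma closedin_eset:
  assumes "e \<in> edges G"
  shows "closedin X (eset D e)"
  using embedding_map_ecurve[OF assms] unfolding eset_def embedding_map_def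
  by (intro closedin_continuous_image_compact[OF Hausdorff])
    (auto dest: homeomorphic_imp_continuous_map continuous_map_into_fulltopology)

lemma closedin_point_set_delete_edges: "closedin X (point_set (delete_edges G F) D)"
  unfolding point_set_def delete_edges_def using finite_edges closedin_eset closedin_vertex_points
  by (intro closedin_Un closedin_Union) auto

lemma closedin_point_set: "closedin X (point_set G D)"
  using closedin_point_set_delete_edges[of "{}"] by (simp add: delete_edges_def)

lemma point_set_locally_two_sided:
  assumes e: "e \<in> edges G" and y: "y \<in> open_edge e"
  shows "locally_two_sided X (point_set G D) y"
proof (rule locally_two_sided_local_cong)
  define Q where "Q = topspace X - point_set (delete_edges G {e}) D"
  show "locally_two_sided X (eset D e) y"
    using y embedded_arc_locally_two_sided[OF surface embedding_map_ecurve[OF e]]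
    by (auto simp: eset_def)
  show "openin X Q"
    using closedin_point_set_delete_edges by (simp add: Q_def openin_diff)
  have "y \<in> topspace X"
    using closedin_subset[OF closedin_eset[OF e]] eset_eq[OF e] y by blast
  then show "y \<in> Q"
    using y open_edge_Int_point_set_delete_edge[OF e] unfolding Q_def by blast
  show "Q \<inter> eset D e = Q \<inter> point_set G D"
    unfolding Q_def point_set_eq_eset_Un_delete_edge[OF e] by blast
qed

lemma
  assumes "f \<in> faces X G D"
  shows face_region_in_regions: "face_region f \<in> regions X G D"
    and closure_of_face_region: "X closure_of face_region f = f"
proof -
  obtain C where C: "C \<in> regions X G D" "f = X closure_of C"
    using assms unfolding faces_def by blast
  then have "face_region f = C"
    by (simp add: face_region_def closure_of_region_Diff)
  then show "face_region f \<in> regions X G D" "X closure_of face_region f = f"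
    using C by simp_all
qed

lemma openin_face_region:
  assumes "f \<in> faces X G D"
  shows "openin X (face_region f)"
proof -
  have opn: "openin X (topspace X - point_set G D)"
    using closedin_point_set by blast
  then have "locally_connected_space (subtopology X (topspace X - point_set G D))"
    by (intro locally_connected_space_open_subset closed_surface_imp_locally_connected_space surface)
  then show ?thesis
    using openin_connected_components_of_locally_connected_space openin_trans_full[OF _ opn]
      face_region_in_regions[OF assms] unfolding regions_def by blast
qed

lemma face_region_nonempty: "f \<in> faces X G D \<Longrightarrow> face_region f \<noteq> {}"
  using face_region_in_regions nonempty_connected_components_of unfolding regions_def by blast

lemma face_region_subset: "f \<in> faces X G D \<Longrightarrow> face_region f \<subseteq> topspace X - vertex_points"
  using openin_subset[OF openin_face_region] by (fastforce simp: face_region_def point_set_def)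

lemma faces_eqI:
  assumes "f \<in> faces X G D" "f' \<in> faces X G D" "y \<in> face_region f" "y \<in> face_region f'"
  shows "f = f'"
proof -
  have "face_region f = face_region f'"
    using assms face_region_in_regions connected_components_of_overlap unfolding regions_def by blast
  then show ?thesis
    using assms closure_of_face_region by metis
qed

lemma face_edges_subset_face:
  assumes "f \<in> faces X G D" "e \<in> face_edges X G D f"
  shows "eset D e \<subseteq> f"
proof -
  have "eset D e \<subseteq> X frontier_of face_region f"
    using assms(2) by (simp add: face_edges_def face_boundary_def face_region_def)
  then show ?thesis
    using closure_of_face_region[OF assms(1)] by (auto simp: frontier_of_def)
qed

lemma even_face_boundary_point_on_edge:
  assumes f: "f \<in> faces X G D" "even_face X G D f" and y: "y \<in> f" "y \<in> point_set G D"
  obtains e where "e \<in> face_edges X G D f" "y \<in> eset D e"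
proof -
  obtain vs where vs: "cycle_edges vs \<subseteq> edges G"
      "face_boundary X G D f = (\<Union>e\<in>cycle_edges vs. eset D e)"
    using f(2) unfolding even_face_def cycle_in_def by blast
  have "y \<notin> X interior_of face_region f"
    using y(2) interior_of_subset unfolding face_region_def by fastforce
  then have "y \<in> X frontier_of face_region f"
    using y(1) closure_of_face_region[OF f(1)] by (simp add: frontier_of_def)
  then obtain e where "e \<in> cycle_edges vs" "y \<in> eset D e"
    using vs(2) by (auto simp: face_boundary_def face_region_def)
  then show ?thesis
    using that[of e] vs by (auto simp: face_edges_def)
qed

lemma two_faces_cover_neighbourhood_of_edge_point:
  assumes f: "f \<in> faces X G D" "f' \<in> faces X G D" "f \<noteq> f'"
    and e: "e \<in> face_edges X G D f" "e \<in> face_edges X G D f'" and y: "y \<in> open_edge e"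
  obtains N where "openin X N" "y \<in> N" "N \<subseteq> f \<union> f'"
proof -
  have eG: "e \<in> edges G"
    using e(1) by (simp add: face_edges_def)
  have "face_region f \<noteq> face_region f'"
    using f closure_of_face_region by metis
  moreover have "y \<in> eset D e"
    using y eset_eq[OF eG] by blast
  moreover from this have "y \<in> X closure_of face_region f" "y \<in> X closure_of face_region f'"
    using face_edges_subset_face[OF f(1) e(1)] face_edges_subset_face[OF f(2) e(2)]
      closure_of_face_region[OF f(1)] closure_of_face_region[OF f(2)] by auto
  ultimately obtain N where N: "openin X N" "y \<in> N"
      "N \<subseteq> face_region f \<union> face_region f' \<union> point_set G D"
    using locally_two_sided_meets_two_components[OF point_set_locally_two_sided[OF eG y]]
      face_region_in_regions[OF f(1)] face_region_in_regions[OF f(2)]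
    unfolding regions_def by metis
  define Q where "Q = topspace X - point_set (delete_edges G {e}) D"
  have "openin X (N \<inter> Q)"
    using N(1) closedin_point_set_delete_edges by (simp add: Q_def openin_diff openin_Int)
  moreover have "y \<in> N \<inter> Q"
    using N y openin_subset[OF N(1)] open_edge_Int_point_set_delete_edge[OF eG] unfolding Q_def by blast
  moreover have "N \<inter> Q \<subseteq> f \<union> f'"
  proof -
    have "N \<inter> Q \<subseteq> face_region f \<union> face_region f' \<union> eset D e"
      using N(3) unfolding Q_def point_set_eq_eset_Un_delete_edge[OF eG] by blast
    then show ?thesis
      using face_edges_subset_face[OF f(1) e(1)] unfolding face_region_def by blast
  qed
  ultimately show ?thesis
    by (rule that)
qed

lemma openin_Union_faces_Diff_vertex_points:
  assumes even: "S \<subseteq> {f \<in> faces X G D. even_face X G D f}"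
    and shared: "no_private_element (face_edges X G D) S"
  shows "openin X (\<Union>S - vertex_points)"
proof (subst openin_subopen, intro ballI)
  fix y assume y: "y \<in> \<Union>S - vertex_points"
  then obtain f where f: "f \<in> S" "y \<in> f" "f \<in> faces X G D" "even_face X G D f"
    using even by blast
  have "\<exists>N. openin X N \<and> y \<in> N \<and> N \<subseteq> \<Union>S"
  proof (cases "y \<in> point_set G D")
    case True
    then obtain e where e: "e \<in> face_edges X G D f" "y \<in> eset D e"
      using even_face_boundary_point_on_edge[OF f(3,4,2)] by blast
    then have eG: "e \<in> edges G"
      by (simp add: face_edges_def)
    have "y \<in> open_edge e"
      using e(2) y vpoint_image_subset_vertex_points[OF eG] unfolding eset_eq[OF eG] by blast
    moreover obtain f' where f': "f' \<in> S" "f \<noteq> f'" "e \<in> face_edges X G D f'"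
      using shared f(1) e(1) unfolding no_private_element_def by blast
    ultimately obtain N where "openin X N" "y \<in> N" "N \<subseteq> f \<union> f'"
      using two_faces_cover_neighbourhood_of_edge_point[OF f(3) _ f'(2) e(1) f'(3)] even by blast
    then show ?thesis
      using f(1) f'(1) by blast
  next
    case False
    then have "y \<in> face_region f" "face_region f \<subseteq> \<Union>S"
      using f(1,2) by (auto simp: face_region_def)
    then show ?thesis
      using openin_face_region[OF f(3)] by blast
  qed
  then obtain N where "openin X N" "y \<in> N" "N \<subseteq> \<Union>S"
    by blast
  then show "\<exists>T. openin X T \<and> y \<in> T \<and> T \<subseteq> \<Union>S - vertex_points"
    using y closedin_vertex_points by (intro exI[of _ "N - vertex_points"]) (auto simp: openin_diff)
qed

lemma Union_faces_cover_if_no_private_edge: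
  assumes even: "S \<subseteq> {f \<in> faces X G D. even_face X G D f}"
    and shared: "no_private_element (face_edges X G D) S" and S: "finite S" "S \<noteq> {}"
  shows "topspace X - vertex_points \<subseteq> \<Union>S"
proof -
  have "connectedin X (topspace X - vertex_points)"
    by (rule connectedin_closed_surface_Diff_finite[OF surface finite_vertex_points])
  moreover have "openin X (\<Union>S - vertex_points)"
    by (rule openin_Union_faces_Diff_vertex_points[OF even shared])
  moreover have "openin X (topspace X - \<Union>S)"
  proof -
    have "closedin X f" if "f \<in> S" for f
      using that even closure_of_face_region by (metis closedin_closure_of mem_Collect_eq subsetD)
    then show ?thesis
      using S(1) by (intro openin_diff closedin_Union) auto
  qed
  moreover have "(\<Union>S - vertex_points) \<inter> (topspace X - vertex_points) \<noteq> {}"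
  proof -
    obtain f where "f \<in> S"
      using S(2) by blast
    then show ?thesis
      using face_region_nonempty[of f] face_region_subset[of f] even unfolding face_region_def by blast
  qed
  moreover have "topspace X - vertex_points \<subseteq> (\<Union>S - vertex_points) \<union> (topspace X - \<Union>S)"
      "(\<Union>S - vertex_points) \<inter> (topspace X - \<Union>S) \<inter> (topspace X - vertex_points) = {}"
    by auto
  ultimately show ?thesis
    unfolding connectedin by blast
qed

lemma eq_faces_if_no_private_edge:
  assumes even: "S \<subseteq> {f \<in> faces X G D. even_face X G D f}"
    and shared: "no_private_element (face_edges X G D) S" and S: "finite S" "S \<noteq> {}"
  shows "S = faces X G D"
proof -
  have "f \<in> S" if f: "f \<in> faces X G D" for f
  proof -
    obtain y where y: "y \<in> face_region f"
      using face_region_nonempty[OF f] by blast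
    then obtain f' where f': "f' \<in> S" "y \<in> f'"
      using face_region_subset[OF f] Union_faces_cover_if_no_private_edge[OF even shared S] by blast
    then have "y \<in> face_region f'"
      using y by (simp add: face_region_def)
    then show ?thesis
      using faces_eqI[OF f _ y] f'(1) even by blast
  qed
  then show ?thesis
    using even by blast
qed

lemma parity_independent_face_edges:
  assumes "\<F> \<subseteq> {f \<in> faces X G D. even_face X G D f}" "\<F> \<noteq> faces X G D"
  shows "parity_independent (face_edges X G D) \<F>"
  unfolding parity_independent_def
proof (intro allI impI, elim conjE)
  fix S assume S: "finite S" "S \<subseteq> \<F>" "parity_sum (face_edges X G D) S = {}"
  show "S = {}"
  proof (rule ccontr)
    assume "S \<noteq> {}"
    then have "S = faces X G D"
      using S(1,2) assms(1) no_private_element_if_parity_sum_empty[OF S(3)]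
      by (intro eq_faces_if_no_private_edge) auto
    then show False
      using S(2) assms by blast
  qed
qed

end

section \<open>Edge cuts and side labels\<close>

abbreviation walk :: "'v ugraph \<Rightarrow> 'v \<Rightarrow> 'v \<Rightarrow> bool" where
  "walk G \<equiv> (\<lambda>x y. {x, y} \<in> edges G)\<^sup>*\<^sup>*"

definition connected_graph :: "'v ugraph \<Rightarrow> bool" where
  "connected_graph G \<longleftrightarrow> verts G \<noteq> {} \<and> \<Union>(edges G) \<subseteq> verts G \<and>
     (\<forall>x\<in>verts G. \<forall>y\<in>verts G. walk G x y)"

definition edge_cut :: "'v ugraph \<Rightarrow> ('v \<Rightarrow> bool) \<Rightarrow> 'v set set \<Rightarrow> bool" where
  "edge_cut G p S \<longleftrightarrow> (\<forall>x y. {x, y} \<in> edges G \<longrightarrow> ({x, y} \<in> S \<longleftrightarrow> p x \<noteq> p y))"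

lemma connected_graph_walk:
  assumes "connected_graph G" "x \<in> verts G" "y \<in> verts G"
  shows "walk G x y"
  using assms by (simp add: connected_graph_def)

lemma connected_graph_edge_verts:
  "connected_graph G \<Longrightarrow> {x, y} \<in> edges G \<Longrightarrow> x \<in> verts G \<and> y \<in> verts G"
  unfolding connected_graph_def by blast

lemma connected_component_graph_imp_connected_graph:
  assumes "\<Union>(edges G) \<subseteq> verts G" "connected_component_graph H G"
  shows "connected_graph H"
proof -
  obtain v where v: "v \<in> verts G"
      and H: "H = (component_of G v, {e \<in> edges G. e \<subseteq> component_of G v})"
    using assms(2) unfolding connected_component_graph_def component_sets_def by blast
  have walk_from_v: "walk H v x" if "x \<in> verts H" for x
  proof -
    have "walk G v x"
      using that by (simp add: H component_of_def)
    then show ?thesis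
    proof (induction rule: rtranclp_induct)
      case (step x y)
      then have "{x, y} \<subseteq> component_of G v"
        using assms(1) by (auto simp: component_of_def intro: rtranclp.rtrancl_into_rtrancl)
      then show ?case
        using step by (auto simp: H intro: rtranclp.rtrancl_into_rtrancl)
    qed simp
  qed
  have "symp (walk H)"
    by (intro symp_rtranclp sympI) (simp add: insert_commute)
  then have "walk H x y" if "x \<in> verts H" "y \<in> verts H" for x y
    using walk_from_v that by (meson rtranclp_trans sympD)
  moreover have "v \<in> verts H"
    using v by (simp add: H component_of_def)
  ultimately show ?thesis
    by (auto simp: connected_graph_def H)
qed

lemma component_of_eq_if_edge:
  assumes "{x, y} \<in> edges G"
  shows "component_of G x = component_of G y"
proof -
  have "(\<lambda>x y. {x, y} \<in> edges G) x y" "(\<lambda>x y. {x, y} \<in> edges G) y x"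
    using assms by (auto simp: insert_commute)
  then show ?thesis
    unfolding component_of_def by (auto intro: converse_rtranclp_into_rtranclp)
qed

lemma component_sets_delete_edge_cut:
  assumes cut: "edge_cut H p S" and C: "C \<in> component_sets (delete_edges H S)"
  shows "C \<noteq> {}" and "x \<in> C \<Longrightarrow> y \<in> C \<Longrightarrow> p x = p y"
proof -
  obtain v where v: "v \<in> verts H" "C = component_of (delete_edges H S) v"
    using C by (auto simp: component_sets_def delete_edges_def)
  then show "C \<noteq> {}"
    by (auto simp: component_of_def delete_edges_def)
  have "p x = p v" if "x \<in> C" for x
  proof -
    have "(\<lambda>x y. {x, y} \<in> edges H - S)\<^sup>*\<^sup>* v x"
      using that by (simp add: v(2) component_of_def delete_edges_def)
    then show ?thesis
    proof (induction rule: rtranclp_induct)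
      case (step x y)
      then show ?case
        using cut by (auto simp: edge_cut_def)
    qed simp
  qed
  then show "x \<in> C \<Longrightarrow> y \<in> C \<Longrightarrow> p x = p y"
    by simp
qed

lemma bipartite_quotient_graph_edge_cut:
  assumes cut: "edge_cut H p S"
  shows "bipartite (quotient_graph H S)"
proof -
  define \<C> where "\<C> = component_sets (delete_edges H S)"
  note component = component_sets_delete_edge_cut[OF cut, folded \<C>_def]
  define A B where "A = {C \<in> \<C>. \<exists>x\<in>C. \<not> p x}" and "B = {C \<in> \<C>. \<exists>x\<in>C. p x}"
  have "bipartition (quotient_graph H S) A B"
    unfolding bipartition_def
  proof (intro conjI ballI)
    show "A \<union> B = verts (quotient_graph H S)"
      using component(1) unfolding A_def B_def by (auto simp: quotient_graph_def \<C>_def)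
    show "A \<inter> B = {}"
      using component(2) unfolding A_def B_def by blast
    fix e assume "e \<in> edges (quotient_graph H S)"
    then obtain C C' x y where e: "e = {C, C'}" and C: "C \<in> \<C>" "C' \<in> \<C>" "x \<in> C" "y \<in> C'"
        and "{x, y} \<in> edges H \<inter> S"
      unfolding quotient_graph_def \<C>_def by auto
    then have "p x \<noteq> p y"
      using cut by (auto simp: edge_cut_def)
    then have "C \<in> A \<and> C' \<in> B \<or> C' \<in> A \<and> C \<in> B"
      using C unfolding A_def B_def by blast
    then show "\<exists>a\<in>A. \<exists>b\<in>B. e = {a, b}"
      using e by (metis insert_commute)
  qed
  then show ?thesis
    unfolding bipartite_def by blast
qed

lemma side_label_in_01: "side_label H S A x \<in> {0, 1}"
  by (simp add: side_label_def)

lemma side_label_edge: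
  assumes bip: "bipartition (quotient_graph H S) A B"
    and xy: "{x, y} \<in> edges H" "x \<in> verts H" "y \<in> verts H"
  shows "side_label H S A x \<noteq> side_label H S A y \<longleftrightarrow> {x, y} \<in> S"
proof (cases "{x, y} \<in> S")
  case True
  define C where "C v = component_of (delete_edges H S) v" for v
  have C: "v \<in> C v" "C v \<in> component_sets (delete_edges H S)" if "v \<in> verts H" for v
    using that by (auto simp: C_def component_of_def component_sets_def delete_edges_def)
  have "{C x, C y} \<in> edges (quotient_graph H S)"
    unfolding quotient_graph_def snd_conv
    using C[OF xy(2)] C[OF xy(3)] xy(1) True by (intro CollectI exI[of _ "C x"] exI[of _ "C y"]) auto
  then obtain a b where "a \<in> A" "b \<in> B" "{C x, C y} = {a, b}" "A \<inter> B = {}"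
    using bip unfolding bipartition_def by meson
  then have "(C x \<in> A) \<noteq> (C y \<in> A)"
    by (auto simp: doubleton_eq_iff)
  then show ?thesis
    using True by (auto simp: side_label_def C_def)
next
  case False
  then have "{x, y} \<in> edges (delete_edges H S)"
    using xy by (simp add: delete_edges_def)
  then show ?thesis
    using False component_of_eq_if_edge by (metis side_label_def)
qed

lemma side_label_neq_iff_edge_cut:
  assumes H: "connected_graph H" and bip: "bipartition (quotient_graph H S) A B"
    and cut: "edge_cut H p S" and x: "x \<in> verts H" and y: "y \<in> verts H"
  shows "side_label H S A x \<noteq> side_label H S A y \<longleftrightarrow> p x \<noteq> p y"
  using connected_graph_walk[OF H x y]
proof (induction rule: rtranclp_induct)
  case (step y z)
  have "side_label H S A y \<noteq> side_label H S A z \<longleftrightarrow> {y, z} \<in> S"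
    using side_label_edge[OF bip step(2)] connected_graph_edge_verts[OF H step(2)] by blast
  also have "\<dots> \<longleftrightarrow> p y \<noteq> p z"
    using cut step(2) by (simp add: edge_cut_def)
  finally show ?case
    using step.IH side_label_in_01[of H S A x] side_label_in_01[of H S A y]
      side_label_in_01[of H S A z] by auto
qed simp

lemma hypercube_edge_iff:
  assumes "xs \<in> verts (hypercube k)" "ys \<in> verts (hypercube k)"
  shows "{xs, ys} \<in> edges (hypercube k) \<longleftrightarrow> card {i. i < k \<and> xs ! i \<noteq> ys ! i} = 1"
proof -
  have "{i. i < k \<and> ys ! i \<noteq> xs ! i} = {i. i < k \<and> xs ! i \<noteq> ys ! i}"
    by auto
  then show ?thesis
    using assms unfolding hypercube_def by (auto simp: Let_def doubleton_eq_iff)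
qed

lemma induced_hypercube_embeddingI:
  fixes L :: "nat \<Rightarrow> 'v \<Rightarrow> nat"
  assumes binary: "\<And>i x. i < k \<Longrightarrow> x \<in> verts H \<Longrightarrow> L i x \<in> {0, 1}"
    and separated: "\<And>x y. x \<in> verts H \<Longrightarrow> y \<in> verts H \<Longrightarrow> {i. i < k \<and> L i x \<noteq> L i y} = {} \<Longrightarrow> x = y"
    and edge_iff: "\<And>x y. x \<in> verts H \<Longrightarrow> y \<in> verts H \<Longrightarrow>
      {x, y} \<in> edges H \<longleftrightarrow> card {i. i < k \<and> L i x \<noteq> L i y} = 1"
  shows "induced_subgraph_embedding (\<lambda>x. map (\<lambda>i. L i x) [0..<k]) H (hypercube k)"
proof -
  define l where "l x = map (\<lambda>i. L i x) [0..<k]" for x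
  have l_nth: "{i. i < k \<and> l x ! i \<noteq> l y ! i} = {i. i < k \<and> L i x \<noteq> L i y}" for x y
    by (auto simp: l_def)
  have l_verts: "l x \<in> verts (hypercube k)" if "x \<in> verts H" for x
    using binary[OF _ that] by (auto simp: l_def hypercube_def Let_def image_subset_iff)
  moreover have "inj_on l (verts H)"
  proof (rule inj_onI)
    fix x y assume "x \<in> verts H" "y \<in> verts H" "l x = l y"
    then show "x = y"
      using separated[of x y] l_nth[of x y] by simp
  qed
  moreover have "{x, y} \<in> edges H \<longleftrightarrow> {l x, l y} \<in> edges (hypercube k)"
    if "x \<in> verts H" "y \<in> verts H" for x y
    using edge_iff hypercube_edge_iff l_verts that by (simp add: l_nth)
  ultimately have "induced_subgraph_embedding l H (hypercube k)"
    by (auto simp: induced_subgraph_embedding_def)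
  then show ?thesis
    by (simp add: l_def[abs_def])
qed

lemma card_indices_distinct:
  assumes "distinct xs" "T \<subseteq> set xs"
  shows "card {i. i < length xs \<and> xs ! i \<in> T} = card T"
proof -
  have "card {i. i < length xs \<and> xs ! i \<in> T} = length (filter (\<lambda>x. x \<in> T) xs)"
    by (simp add: length_filter_conv_card)
  also have "\<dots> = card (set (filter (\<lambda>x. x \<in> T) xs))"
    using assms(1) distinct_card[of "filter (\<lambda>x. x \<in> T) xs"] by simp
  also have "set (filter (\<lambda>x. x \<in> T) xs) = T"
    using assms(2) by auto
  finally show ?thesis .
qed

section \<open>Flip graphs\<close>

locale flip_graph =
  fixes H :: "'e set ugraph" and E :: "'f \<Rightarrow> 'e set" and F :: "'f set"
  assumes connected: "connected_graph H"
    and independent: "parity_independent E F"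
    and edge_iff_flip: "M \<in> verts H \<Longrightarrow> M' \<in> verts H \<Longrightarrow>
      {M, M'} \<in> edges H \<longleftrightarrow> (\<exists>f\<in>F. sym_diff M M' = E f)"
begin

definition flips :: "'e set \<Rightarrow> 'e set \<Rightarrow> 'f set" where
  "flips M M' = (THE S. finite S \<and> S \<subseteq> F \<and> parity_sum E S = sym_diff M M')"

definition flip_edges :: "'f \<Rightarrow> 'e set set set" where
  "flip_edges f = {{M, M'} | M M'. {M, M'} \<in> edges H \<and> sym_diff M M' = E f}"

lemma flips_eqI:
  assumes "finite S" "S \<subseteq> F" "parity_sum E S = sym_diff M M'"
  shows "flips M M' = S"
  unfolding flips_def
proof (rule the_equality)
  show "T = S" if "finite T \<and> T \<subseteq> F \<and> parity_sum E T = sym_diff M M'" for T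
    using that assms by (intro parity_sum_inject[OF independent]) simp_all
qed (use assms in simp)

lemma flips_exist:
  assumes "M \<in> verts H" "M' \<in> verts H"
  shows "\<exists>S. finite S \<and> S \<subseteq> F \<and> parity_sum E S = sym_diff M M'"
  using connected_graph_walk[OF connected assms]
proof (induction rule: rtranclp_induct)
  case base
  show ?case
    by (rule exI[of _ "{}"]) simp
next
  case (step N N')
  then obtain S where S: "finite S" "S \<subseteq> F" "parity_sum E S = sym_diff M N"
    by blast
  obtain f where f: "f \<in> F" "sym_diff N N' = E f"
    using step(2) edge_iff_flip connected_graph_edge_verts[OF connected] by blast
  have "parity_sum E (sym_diff S {f}) = sym_diff (sym_diff M N) (sym_diff N N')"
    using S f by (simp add: parity_sum_sym_diff)
  also have "\<dots> = sym_diff M N'"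
    by blast
  finally show ?case
    using S f by (intro exI[of _ "sym_diff S {f}"]) auto
qed

lemma
  assumes "M \<in> verts H" "M' \<in> verts H"
  shows finite_flips: "finite (flips M M')" and flips_subset: "flips M M' \<subseteq> F"
    and parity_sum_flips: "parity_sum E (flips M M') = sym_diff M M'"
  using flips_exist[OF assms] flips_eqI by metis+

lemma flips_eq_empty_iff: "M \<in> verts H \<Longrightarrow> M' \<in> verts H \<Longrightarrow> flips M M' = {} \<longleftrightarrow> M = M'"
  using parity_sum_flips[of M M'] flips_eqI[of "{}" M M'] by auto

lemma flips_eq_singleton_iff:
  "M \<in> verts H \<Longrightarrow> M' \<in> verts H \<Longrightarrow> f \<in> F \<Longrightarrow> flips M M' = {f} \<longleftrightarrow> sym_diff M M' = E f"
  using parity_sum_flips[of M M'] flips_eqI[of "{f}" M M'] by auto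

lemma flips_sym_diff:
  assumes "M \<in> verts H" "M' \<in> verts H" "M'' \<in> verts H"
  shows "flips M M'' = sym_diff (flips M M') (flips M' M'')"
proof (rule flips_eqI)
  have "sym_diff M M'' = sym_diff (sym_diff M M') (sym_diff M' M'')"
    by blast
  then show "parity_sum E (sym_diff (flips M M') (flips M' M'')) = sym_diff M M''"
    using assms by (simp add: parity_sum_sym_diff finite_flips parity_sum_flips)
  show "finite (sym_diff (flips M M') (flips M' M''))"
    using assms by (simp add: finite_flips)
  show "sym_diff (flips M M') (flips M' M'') \<subseteq> F"
    using flips_subset[OF assms(1,2)] flips_subset[OF assms(2,3)] by blast
qed

lemma edge_iff_card_flips:
  assumes "M \<in> verts H" "M' \<in> verts H"
  shows "{M, M'} \<in> edges H \<longleftrightarrow> card (flips M M') = 1"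
proof -
  have "{M, M'} \<in> edges H \<longleftrightarrow> (\<exists>f\<in>F. flips M M' = {f})"
    using assms edge_iff_flip flips_eq_singleton_iff by simp
  also have "\<dots> \<longleftrightarrow> card (flips M M') = 1"
    using flips_subset[OF assms] by (auto simp: card_1_singleton_iff)
  finally show ?thesis .
qed

lemma edge_cut_flip_edges:
  assumes "f \<in> F" "M \<in> verts H"
  shows "edge_cut H (\<lambda>N. f \<in> flips M N) (flip_edges f)"
  unfolding edge_cut_def
proof (intro allI impI)
  fix N N' assume edge: "{N, N'} \<in> edges H"
  then have N: "N \<in> verts H" "N' \<in> verts H"
    using connected_graph_edge_verts[OF connected] by auto
  obtain g where "flips N N' = {g}"
    using edge edge_iff_card_flips[OF N] by (auto simp: card_1_singleton_iff)
  then have "f \<in> flips N N' \<longleftrightarrow> flips N N' = {f}"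
    by auto
  also have "\<dots> \<longleftrightarrow> {N, N'} \<in> flip_edges f"
    using flips_eq_singleton_iff[OF N assms(1)] edge
    by (auto simp: flip_edges_def doubleton_eq_iff Un_commute)
  finally show "{N, N'} \<in> flip_edges f \<longleftrightarrow> (f \<in> flips M N) \<noteq> (f \<in> flips M N')"
    using flips_sym_diff[OF assms(2) N] by auto
qed

lemma bipartite_quotient_flip_edges:
  assumes "f \<in> F"
  shows "bipartite (quotient_graph H (flip_edges f))"
proof -
  obtain M where "M \<in> verts H"
    using connected unfolding connected_graph_def by blast
  then show ?thesis
    using bipartite_quotient_graph_edge_cut edge_cut_flip_edges[OF assms] by blast
qed

lemma side_label_neq_iff_flips:
  assumes "f \<in> F" "bipartition (quotient_graph H (flip_edges f)) A B" "M \<in> verts H" "M' \<in> verts H"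
  shows "side_label H (flip_edges f) A M \<noteq> side_label H (flip_edges f) A M' \<longleftrightarrow> f \<in> flips M M'"
proof -
  have "flips M M = {}"
    using assms(3) flips_eq_empty_iff by simp
  then show ?thesis
    using side_label_neq_iff_edge_cut[OF connected assms(2) edge_cut_flip_edges[OF assms(1,3)] assms(3,4)]
    by simp
qed

lemma side_labels_induced_hypercube_embedding:
  assumes fs: "distinct fs" "set fs = F"
    and bip: "\<And>i. i < length fs \<Longrightarrow> bipartition (quotient_graph H (flip_edges (fs ! i))) (A i) (B i)"
  shows "induced_subgraph_embedding
           (\<lambda>M. map (\<lambda>i. side_label H (flip_edges (fs ! i)) (A i) M) [0..<length fs])
           H (hypercube (length fs))"
proof (rule induced_hypercube_embeddingI)
  let ?L = "\<lambda>i M. side_label H (flip_edges (fs ! i)) (A i) M"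
  have differing: "{i. i < length fs \<and> ?L i M \<noteq> ?L i M'} = {i. i < length fs \<and> fs ! i \<in> flips M M'}"
    if "M \<in> verts H" "M' \<in> verts H" for M M'
    using that side_label_neq_iff_flips[OF _ bip] fs(2) nth_mem by blast
  have card_differing: "card {i. i < length fs \<and> ?L i M \<noteq> ?L i M'} = card (flips M M')"
    if "M \<in> verts H" "M' \<in> verts H" for M M'
    using that card_indices_distinct[OF fs(1)] flips_subset fs(2) by (simp add: differing)
  fix M M' assume M: "M \<in> verts H" "M' \<in> verts H"
  show "{M, M'} \<in> edges H \<longleftrightarrow> card {i. i < length fs \<and> ?L i M \<noteq> ?L i M'} = 1"
    using M edge_iff_card_flips by (simp add: card_differing)
  assume "{i. i < length fs \<and> ?L i M \<noteq> ?L i M'} = {}"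
  then have "card (flips M M') = 0"
    using card_differing[OF M] by (metis card.empty)
  then show "M = M'"
    using finite_flips[OF M] flips_eq_empty_iff[OF M] by simp
qed (rule side_label_in_01)

end

lemma resonance_component_flip_graph:
  assumes indep: "parity_independent (face_edges X G D) \<F>"
    and H: "connected_component_graph H (resonance_graph X G D \<F>)"
  shows "flip_graph H (face_edges X G D) (corresponding_faces X G D \<F> H)"
proof
  show "connected_graph H"
    by (rule connected_component_graph_imp_connected_graph[OF _ H]) (auto simp: resonance_graph_def)
  show "parity_independent (face_edges X G D) (corresponding_faces X G D \<F> H)"
    by (rule parity_independent_subset[OF indep]) (auto simp: corresponding_faces_def)
  fix M M' assume M: "M \<in> verts H" "M' \<in> verts H"
  obtain C where C: "H = (C, {e \<in> edges (resonance_graph X G D \<F>). e \<subseteq> C})"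
      "C \<subseteq> verts (resonance_graph X G D \<F>)"
    using H unfolding connected_component_graph_def component_sets_def component_of_def by auto
  then have "perfect_matching G M" "perfect_matching G M'"
    using M by (auto simp: resonance_graph_def)
  then have "{M, M'} \<in> edges H \<longleftrightarrow> (\<exists>f\<in>\<F>. sym_diff M M' = face_edges X G D f)"
    using M C(1) by (auto simp: resonance_graph_def doubleton_eq_iff Un_commute)
  then show "{M, M'} \<in> edges H \<longleftrightarrow>
      (\<exists>f\<in>corresponding_faces X G D \<F> H. sym_diff M M' = face_edges X G D f)"
    unfolding corresponding_faces_def corresponding_edges_def by blast
qed

theorem theorem3p5:
  fixes X :: "'s topology"
    and G :: "'v ugraph"
    and D :: "('v, 's) drawing"
    and \<F> :: "'s set set"
    and H :: "'v set set ugraph"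
    and fs :: "'s set list"
  assumes "closed_surface X"
    and "finite_simple_graph G"
    and "embedded_in X G D"
    and "\<F> \<subseteq> {f \<in> faces X G D. even_face X G D f}"
    and "\<F> \<noteq> faces X G D"
    and "connected_component_graph H (resonance_graph X G D \<F>)"
    and "distinct fs"
    and "set fs = corresponding_faces X G D \<F> H"
  shows "(\<forall>i<length fs. bipartite (quotient_graph H (corresponding_edges X G D H (fs ! i)))) \<and>
         (\<forall>A B. (\<forall>i<length fs.
                   bipartition (quotient_graph H (corresponding_edges X G D H (fs ! i))) (A i) (B i))
            \<longrightarrow> induced_subgraph_embedding
                  (\<lambda>M. map (\<lambda>i. side_label H (corresponding_edges X G D H (fs ! i)) (A i) M)
                           [0..<length fs])
                  H (hypercube (length fs)))"
proof -
  interpret embedded_graph X G D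
    by standard (fact assms)+
  interpret flip_graph H "face_edges X G D" "set fs"
    unfolding assms(8)
    by (intro resonance_component_flip_graph parity_independent_face_edges assms(4-6))
  have corresponding_edges: "corresponding_edges X G D H f = flip_edges f" for f
    by (simp add: corresponding_edges_def flip_edges_def)
  show ?thesis
    unfolding corresponding_edges
  proof (intro conjI allI impI)
    fix i assume "i < length fs"
    then show "bipartite (quotient_graph H (flip_edges (fs ! i)))"
      by (intro bipartite_quotient_flip_edges nth_mem)
  next
    fix A B assume "\<forall>i<length fs. bipartition (quotient_graph H (flip_edges (fs ! i))) (A i) (B i)"
    then show "induced_subgraph_embedding
        (\<lambda>M. map (\<lambda>i. side_label H (flip_edges (fs ! i)) (A i) M) [0..<length fs])
        H (hypercube (length fs))"
      by (intro side_labels_induced_hypercube_embedding[OF assms(7) refl, of A B]) simp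
  qed
qed

end
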